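(* For every integer $n\ge 1$, $b(n)=1+2^{n-1}$.
   Context: The board is the set of cells $\mathcal A=\{0,1\}^n$ (the vertices of the $n$-dimensional hypercube). Two cells are neighbors if their Hamming distance is $1$. The neighbors of a set $R\subseteq\mathcal A$ are the cells not in $R$ that have a neighbor in $R$. A height function is a map $h:\mathcal A\to\mathbb R$. A (hypercubic) island of $h$ is a sub-hypercube $R\subseteq \mathcal A$ (a set obtained by fixing the values of some, possibly none or all, of the coordinates and leaving the others free, so of any dimension from $0$ to $n$) such that the minimum of $h$ on $R$ is strictly greater than the maximum of $h$ on the neighbors of $R$; the whole space $\mathcal A$, having no neighbors, always counts as an island. $b(n)$ denotes the maximum, over all height functions $h$, of the number of hypercubic islands of $h$. *)

theory Defs
  imports Complex_Main "HOL-Library.FuncSet"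
begin

definition cells :: "nat \<Rightarrow> (nat \<Rightarrow> nat) set" where
  "cells n = {..<n} \<rightarrow>\<^sub>E {0, 1}"

definition hamming :: "nat \<Rightarrow> (nat \<Rightarrow> nat) \<Rightarrow> (nat \<Rightarrow> nat) \<Rightarrow> nat" where
  "hamming n x y = card {i \<in> {..<n}. x i \<noteq> y i}"

definition neighbors :: "nat \<Rightarrow> (nat \<Rightarrow> nat) set \<Rightarrow> (nat \<Rightarrow> nat) set" where
  "neighbors n R = {y \<in> cells n. y \<notin> R \<and> (\<exists>x\<in>R. hamming n x y = 1)}"

(* F is the set of fixed coordinates and a prescribes their values. *)
definition subcube :: "nat \<Rightarrow> (nat \<Rightarrow> nat) set \<Rightarrow> bool" where
  "subcube n R \<longleftrightarrow>
     (\<exists>F a. F \<subseteq> {..<n} \<and> a \<in> cells n \<and> R = {x \<in> cells n. \<forall>i\<in>F. x i = a i})"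

(* Only the values of h on cells n matter. The whole space has no neighbors, so it needs its
   own disjunct: Max of the empty set is unspecified. *)
definition island :: "nat \<Rightarrow> ((nat \<Rightarrow> nat) \<Rightarrow> real) \<Rightarrow> (nat \<Rightarrow> nat) set \<Rightarrow> bool" where
  "island n h R \<longleftrightarrow>
     subcube n R \<and> (R = cells n \<or> Max (h ` neighbors n R) < Min (h ` R))"

definition num_islands :: "nat \<Rightarrow> ((nat \<Rightarrow> nat) \<Rightarrow> real) \<Rightarrow> nat" where
  "num_islands n h = card {R. island n h R}"

definition max_islands :: "nat \<Rightarrow> nat" where
  "max_islands n = Max (range (num_islands n))"

(* The maxima, minima and cardinalities above are taken over finite nonempty sets
   (for islands other than the whole space, in the case of neighbors). *)

lemma finite_cells: "finite (cells n)"
  by (simp add: cells_def finite_PiE)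

lemma finite_neighbors: "finite (neighbors n R)"
  by (simp add: neighbors_def finite_cells)

lemma subcube_subset: "subcube n R \<Longrightarrow> R \<subseteq> cells n"
  by (auto simp: subcube_def)

lemma island_subset: "island n h R \<Longrightarrow> R \<subseteq> cells n"
  using subcube_subset by (simp add: island_def)

lemma subcube_nonempty: "subcube n R \<Longrightarrow> R \<noteq> {}"
  by (auto simp: subcube_def)

lemma finite_islands: "finite {R. island n h R}"
proof (rule finite_subset)
  show "{R. island n h R} \<subseteq> Pow (cells n)"
    using island_subset by blast
qed (simp add: finite_cells)

lemma finite_range_num_islands: "finite (range (num_islands n))"
proof (rule finite_subset)
  have "num_islands n h \<le> card (Pow (cells n))" for h
    unfolding num_islands_def
    by (rule card_mono) (simp add: finite_cells, use island_subset in blast)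
  then show "range (num_islands n) \<subseteq> {..card (Pow (cells n))}" by auto
qed simp

lemma neighbors_subcube_nonempty:
  assumes "subcube n R" "R \<noteq> cells n"
  shows "neighbors n R \<noteq> {}"
proof -
  obtain F a where F: "F \<subseteq> {..<n}" and a: "a \<in> cells n"
    and R: "R = {x \<in> cells n. \<forall>i\<in>F. x i = a i}"
    using assms(1) by (auto simp: subcube_def)
  obtain i where i: "i \<in> F" using assms(2) R by auto
  define y where "y = a(i := 1 - a i)"
  have "i < n" using F i by auto
  have "a i \<in> {0, 1}" using a \<open>i < n\<close> by (auto simp: cells_def PiE_iff)
  then have ne: "y i \<noteq> a i" by (auto simp: y_def)
  have "y \<in> cells n"
    using a \<open>i < n\<close> by (auto simp: y_def cells_def PiE_iff extensional_def)
  moreover have "y \<notin> R" using R i ne by auto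
  moreover have "{j \<in> {..<n}. a j \<noteq> y j} = {i}"
    using ne \<open>i < n\<close> by (auto simp: y_def)
  then have "hamming n a y = 1" by (simp add: hamming_def)
  moreover have "a \<in> R" using a R by simp
  ultimately show ?thesis by (auto simp: neighbors_def)
qed

end

theory Submission
  imports Defs
begin

text \<open>
  For the lower bound, let the height be the indicator of the cells of even coordinate sum. All
  neighbors of an even cell are odd, so each of the \<open>2 ^ (n - 1)\<close> even cells is an island by
  itself, and the whole board is one more island.

  For the upper bound, only one property of islands matters: two of them are nested or lie at
  Hamming distance at least two (\<open>islands_nested_or_far\<close>). If two islands touched or overlapped
  without being nested, each would contain a neighbor of the other, and each would then have to be
  strictly higher than the other. It remains to show that a family of proper subcubes of a subcube
  \<open>Q\<close> with this property has at most \<open>card Q / 2\<close> members (\<open>separated_card_le\<close>). Cut \<open>Q\<close> into two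
  halves along a coordinate and pass to the traces of the family in the halves. The family has no
  more members than there are nonempty traces (\<open>card_le_slices\<close>): two members may share
  one trace, namely when one is a half of the other, but the two halves of a subcube are adjacent,
  so they cannot both be members, and one trace always remains free for the subcube itself.
  Induction on each half gives the bound. The induction needs traces that are proper in their
  halves, and this fails only if a half of \<open>Q\<close> belongs to the family; then that half
  contains all other members, and induction on it alone suffices.
\<close>

section \<open>Cells and subcubes\<close>

lemma card_cells: "card (cells n) = 2 ^ n"
  by (simp add: cells_def card_PiE numeral_2_eq_2)

lemma cells_upd: "x \<in> cells n \<Longrightarrow> i < n \<Longrightarrow> v \<in> {0, 1} \<Longrightarrow> x(i := v) \<in> cells n"
  by (auto simp: cells_def PiE_iff extensional_def)

lemma cells_value: "x \<in> cells n \<Longrightarrow> i < n \<Longrightarrow> x i = 0 \<or> x i = 1"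
  by (auto simp: cells_def PiE_iff)

lemma cells_differ_less: "x \<in> cells n \<Longrightarrow> y \<in> cells n \<Longrightarrow> x i \<noteq> y i \<Longrightarrow> i < n"
  by (rule ccontr) (auto simp: cells_def PiE_iff extensional_def)

lemma hamming_refl: "hamming n x x = 0"
  by (simp add: hamming_def)

lemma hamming_commute: "hamming n x y = hamming n y x"
  by (simp add: hamming_def eq_commute)

lemma hamming_upd: "i < n \<Longrightarrow> v \<noteq> x i \<Longrightarrow> hamming n x (x(i := v)) = 1"
proof -
  assume "i < n" "v \<noteq> x i"
  then have "{j \<in> {..<n}. x j \<noteq> (x(i := v)) j} = {i}" by auto
  then show ?thesis by (simp add: hamming_def)
qed

lemma hamming_eq_0_iff:
  assumes "x \<in> cells n" "y \<in> cells n"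
  shows "hamming n x y = 0 \<longleftrightarrow> x = y"
  using cells_differ_less[OF assms] by (auto simp: hamming_def)

lemma hamming_eq_1E:
  assumes "x \<in> cells n" "y \<in> cells n" "hamming n x y = 1"
  obtains i where "i < n" "y = x(i := 1 - x i)"
proof -
  obtain i where i: "{j \<in> {..<n}. x j \<noteq> y j} = {i}"
    using assms(3) by (auto simp: hamming_def card_1_singleton_iff)
  then have "i \<in> {j \<in> {..<n}. x j \<noteq> y j}" by simp
  then have "i < n" "x i \<noteq> y i" by auto
  moreover have "y j = x j" if "j \<noteq> i" for j
  proof (rule ccontr)
    assume "y j \<noteq> x j"
    then have "j \<in> {j \<in> {..<n}. x j \<noteq> y j}"
      using cells_differ_less[OF assms(1,2), of j] by simp
    then show False using i that by blast
  qed
  ultimately have "y = x(i := 1 - x i)"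
    using cells_value[OF assms(1), of i] cells_value[OF assms(2), of i]
    by (intro ext) auto
  then show ?thesis using that \<open>i < n\<close> by blast
qed

lemma subcube_through:
  assumes "subcube n R" "x \<in> R"
  obtains F where "F \<subseteq> {..<n}" "R = {y \<in> cells n. \<forall>i\<in>F. y i = x i}"
proof -
  obtain F a where F: "F \<subseteq> {..<n}" "R = {y \<in> cells n. \<forall>i\<in>F. y i = a i}"
    using assms(1) by (auto simp: subcube_def)
  then have "R = {y \<in> cells n. \<forall>i\<in>F. y i = x i}" using assms(2) by auto
  then show ?thesis using that F by blast
qed

definition crosses :: "(nat \<Rightarrow> nat) set \<Rightarrow> nat \<Rightarrow> bool" where
  "crosses R i \<longleftrightarrow> (\<exists>x\<in>R. \<exists>y\<in>R. x i \<noteq> y i)"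

definition slice :: "(nat \<Rightarrow> nat) set \<Rightarrow> nat \<Rightarrow> nat \<Rightarrow> (nat \<Rightarrow> nat) set" where
  "slice R i b = {x \<in> R. x i = b}"

lemma slice_subset: "slice R i b \<subseteq> R"
  by (auto simp: slice_def)

lemma crosses_less: "subcube n R \<Longrightarrow> crosses R i \<Longrightarrow> i < n"
  using subcube_subset cells_differ_less by (fastforce simp: crosses_def)

lemma subcube_upd:
  assumes "subcube n R" "crosses R i" "x \<in> R" "v \<in> {0, 1}"
  shows "x(i := v) \<in> R"
proof -
  obtain F where F: "R = {y \<in> cells n. \<forall>i\<in>F. y i = x i}"
    using subcube_through[OF assms(1,3)] by blast
  then have "i \<notin> F" using assms(2) by (force simp: crosses_def)
  then show ?thesis
    using F assms cells_upd[of x n i v] crosses_less[OF assms(1,2)] by auto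
qed

lemma slice_nonempty:
  assumes "subcube n R" "crosses R i" "b \<in> {0, 1}"
  shows "slice R i b \<noteq> {}"
proof -
  obtain x where "x \<in> R" using assms(2) by (auto simp: crosses_def)
  then have "x(i := b) \<in> slice R i b"
    using subcube_upd[OF assms(1,2) _ assms(3)] by (simp add: slice_def)
  then show ?thesis by blast
qed

lemma subcube_slice:
  assumes "subcube n R" "i < n" "slice R i b \<noteq> {}"
  shows "subcube n (slice R i b)"
proof -
  obtain x where x: "x \<in> R" "x i = b" using assms(3) by (auto simp: slice_def)
  obtain F where F: "F \<subseteq> {..<n}" "R = {y \<in> cells n. \<forall>i\<in>F. y i = x i}"
    using subcube_through[OF assms(1) x(1)] by blast
  have "slice R i b = {y \<in> cells n. \<forall>j\<in>insert i F. y j = x j}"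
    using F(2) x(2) by (auto simp: slice_def)
  moreover have "insert i F \<subseteq> {..<n}" "x \<in> cells n" using F x assms(2) by auto
  ultimately show ?thesis unfolding subcube_def by blast
qed

lemma slice_Un:
  assumes "subcube n R" "crosses R i"
  shows "R = slice R i 0 \<union> slice R i 1"
  using cells_value[OF _ crosses_less[OF assms]] subcube_subset[OF assms(1)]
  by (auto simp: slice_def)

lemma card_slice:
  assumes "subcube n R" "crosses R i" "b \<in> {0, 1}"
  shows "card R = 2 * card (slice R i b)"
proof -
  have "bij_betw (\<lambda>x. x(i := 1)) (slice R i 0) (slice R i 1)"
    by (rule bij_betwI[where g = "\<lambda>x. x(i := 0)"])
      (use subcube_upd[OF assms(1,2)] in \<open>auto simp: slice_def fun_upd_idem\<close>)
  then have eq: "card (slice R i 0) = card (slice R i 1)" by (rule bij_betw_same_card)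
  have "finite R" using subcube_subset[OF assms(1)] finite_cells finite_subset by blast
  then have "card (slice R i 0 \<union> slice R i 1) = card (slice R i 0) + card (slice R i 1)"
    by (intro card_Un_disjoint) (auto simp: slice_def)
  then show ?thesis using slice_Un[OF assms(1,2)] eq assms(3) by auto
qed

text \<open>
  A subcube with a free coordinate \<open>i\<close> is recovered from either of its slices by letting
  coordinate \<open>i\<close> vary; so one slice decides inclusion between two such subcubes.
\<close>

lemma subset_of_slice_subset:
  assumes "subcube n R" "crosses R i" "subcube n S" "crosses S i"
    and "b \<in> {0, 1}" "slice R i b \<subseteq> S"
  shows "R \<subseteq> S"
proof
  fix x assume x: "x \<in> R"
  have "x(i := b) \<in> slice R i b"
    using subcube_upd[OF assms(1,2) x assms(5)] by (simp add: slice_def)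
  then have "x(i := b) \<in> S" using assms(6) by blast
  moreover have "x i \<in> {0, 1}"
    using x cells_value[OF _ crosses_less[OF assms(1,2)]] subcube_subset[OF assms(1)] by auto
  ultimately have "(x(i := b))(i := x i) \<in> S" by (rule subcube_upd[OF assms(3,4)])
  then show "x \<in> S" by simp
qed

lemma proper_subcube_eq_slice:
  assumes "subcube n Q" "crosses Q i" "subcube n R" "R \<subset> Q"
    and "b \<in> {0, 1}" "slice Q i b \<subseteq> R"
  shows "R = slice Q i b"
proof (rule ccontr)
  assume "R \<noteq> slice Q i b"
  then obtain z where z: "z \<in> R" "z \<notin> slice Q i b" using assms(6) by blast
  then have "z i \<noteq> b" using assms(4) by (auto simp: slice_def)
  moreover obtain x where "x \<in> slice Q i b" using slice_nonempty[OF assms(1,2,5)] by blast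
  then have "x \<in> R" "x i = b" using assms(6) by (auto simp: slice_def)
  ultimately have "crosses R i" using z(1) unfolding crosses_def by metis
  then have "Q \<subseteq> R" using subset_of_slice_subset assms by blast
  then show False using assms(4) by blast
qed

section \<open>Separated families of subcubes\<close>

definition far :: "nat \<Rightarrow> (nat \<Rightarrow> nat) set \<Rightarrow> (nat \<Rightarrow> nat) set \<Rightarrow> bool" where
  "far n R S \<longleftrightarrow> (\<forall>x\<in>R. \<forall>y\<in>S. hamming n x y > 1)"

definition nested_or_far :: "nat \<Rightarrow> (nat \<Rightarrow> nat) set \<Rightarrow> (nat \<Rightarrow> nat) set \<Rightarrow> bool" where
  "nested_or_far n R S \<longleftrightarrow> R \<subseteq> S \<or> S \<subseteq> R \<or> far n R S"

definition separated :: "nat \<Rightarrow> (nat \<Rightarrow> nat) set set \<Rightarrow> bool" where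
  "separated n L \<longleftrightarrow> (\<forall>R\<in>L. \<forall>S\<in>L. nested_or_far n R S)"

lemma nested_or_far_slice:
  assumes "nested_or_far n R S"
  shows "nested_or_far n (slice R i b) (slice S i b)"
  using assms by (auto simp: nested_or_far_def far_def slice_def)

lemma slices_not_both_separated:
  assumes "subcube n R" "crosses R i" "separated n L"
    and "slice R i 0 \<in> L"
  shows "slice R i 1 \<notin> L"
proof
  assume "slice R i 1 \<in> L"
  then have s: "nested_or_far n (slice R i 0) (slice R i 1)"
    using assms(3,4) by (simp add: separated_def)
  obtain x where x: "x \<in> slice R i 0" using slice_nonempty[OF assms(1,2)] by blast
  then have y: "x(i := 1) \<in> slice R i 1"
    using subcube_upd[OF assms(1,2)] by (simp add: slice_def)
  have "hamming n x (x(i := 1)) = 1"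
    using x by (intro hamming_upd crosses_less[OF assms(1,2)]) (simp add: slice_def)
  then have "\<not> far n (slice R i 0) (slice R i 1)" using x y by (force simp: far_def)
  then show False using s x y by (auto simp: nested_or_far_def slice_def)
qed

text \<open>
  The injection behind this bound sends a member that lies in one half to itself, and a member
  that meets both halves to a slice of it that is not a member.
\<close>

lemma card_le_slices:
  assumes "finite L" "separated n L" "i < n" and sub: "\<And>R. R \<in> L \<Longrightarrow> subcube n R"
  shows "card L \<le> card ((\<lambda>R. slice R i 0) ` L - {{}}) + card ((\<lambda>R. slice R i 1) ` L - {{}})"
    (is "_ \<le> card ?T0 + card ?T1")
proof -
  define g where "g R = (if \<not> crosses R i then R
      else if slice R i 0 \<notin> L then slice R i 0 else slice R i 1)" for R
  have cross: "g R \<notin> L" "\<exists>b\<in>{0, 1}. g R = slice R i b" if "R \<in> L" "crosses R i" for R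
    using that slices_not_both_separated[OF sub _ assms(2), of R i] by (auto simp: g_def)
  have "inj_on g L"
  proof (rule inj_onI)
    fix R S assume RS: "R \<in> L" "S \<in> L" "g R = g S"
    consider "\<not> crosses R i" "\<not> crosses S i" | "crosses R i" "crosses S i"
      using RS cross(1) g_def by metis
    then show "R = S"
    proof cases
      case 1
      then show ?thesis using RS(3) by (simp add: g_def)
    next
      case 2
      obtain b c where b: "b \<in> {0, 1}" "g R = slice R i b"
        and c: "c \<in> {0, 1}" "g S = slice S i c"
        using cross(2) RS 2 by metis
      have "slice R i b \<subseteq> S" "slice S i c \<subseteq> R" using b c RS(3) slice_subset by metis+
      then show ?thesis
        using subset_of_slice_subset[OF sub 2(1) sub 2(2) b(1)]
          subset_of_slice_subset[OF sub 2(2) sub 2(1) c(1)] RS by blast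
    qed
  qed
  moreover have "g ` L \<subseteq> ?T0 \<union> ?T1"
  proof
    fix A assume "A \<in> g ` L"
    then obtain R where R: "R \<in> L" "A = g R" by blast
    show "A \<in> ?T0 \<union> ?T1"
    proof (cases "crosses R i")
      case True
      then show ?thesis using cross(2)[OF R(1)] slice_nonempty[OF sub[OF R(1)] True] R by auto
    next
      case False
      obtain x where x: "x \<in> R" using subcube_nonempty[OF sub[OF R(1)]] by blast
      then have "slice R i (x i) = R" using False by (auto simp: slice_def crosses_def)
      moreover have "x i = 0 \<or> x i = 1"
        using x subcube_subset[OF sub[OF R(1)]] cells_value[OF _ assms(3)] by blast
      moreover have "A = R" using False R(2) by (simp add: g_def)
      ultimately show ?thesis using R(1) x by force
    qed
  qed
  ultimately have "card L \<le> card (?T0 \<union> ?T1)"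
    using assms(1) by (intro card_inj_on_le) auto
  then show ?thesis using card_Un_le le_trans by blast
qed

text \<open>
  Every cell of \<open>Q\<close> lies in a given half or next to it, so no nonempty subset of \<open>Q\<close> is far from
  the half; and no proper subcube of \<open>Q\<close> is strictly larger than a half.
\<close>

lemma subset_slice_of_separated:
  assumes "subcube n Q" "crosses Q i" "b \<in> {0, 1}"
    and "nested_or_far n (slice Q i b) R" "subcube n R" "R \<subset> Q"
  shows "R \<subseteq> slice Q i b"
proof -
  have "\<not> far n (slice Q i b) R"
  proof
    assume far: "far n (slice Q i b) R"
    obtain x where x: "x \<in> R" using subcube_nonempty[OF assms(5)] by blast
    then have "x(i := b) \<in> slice Q i b"
      using subcube_upd[OF assms(1,2) _ assms(3)] assms(6) by (auto simp: slice_def)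
    then have "hamming n x (x(i := b)) > 1" using far x hamming_commute by (metis far_def)
    then show False
      using hamming_upd[OF crosses_less[OF assms(1,2)], of b x] hamming_refl[of n x]
      by (cases "b = x i") auto
  qed
  then show ?thesis
    using assms(4) proper_subcube_eq_slice[OF assms(1,2,5,6,3)] by (auto simp: nested_or_far_def)
qed

theorem separated_card_le:
  assumes "subcube n Q" "separated n L" "\<And>R. R \<in> L \<Longrightarrow> subcube n R \<and> R \<subset> Q"
  shows "2 * card L \<le> card Q"
  using assms
proof (induction "card Q" arbitrary: Q L rule: less_induct)
  case less
  have finQ: "finite Q" using subcube_subset[OF less.prems(1)] finite_cells finite_subset by blast
  have finL: "finite L"
    by (rule finite_subset[of _ "Pow Q"]) (use less.prems(3) finQ in auto)
  show ?case
  proof (cases "L = {}")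
    case False
    then obtain R where "R \<in> L" by blast
    then have "R \<noteq> {}" "R \<subset> Q" using less.prems(3) subcube_nonempty by blast+
    then obtain x y where "x \<in> Q" "y \<in> Q" "x \<noteq> y" by blast
    then obtain i where cr: "crosses Q i" by (auto simp: crosses_def fun_eq_iff)
    note i = crosses_less[OF less.prems(1) cr]
    have card: "card Q = 2 * card (slice Q i b)" if "b \<in> {0, 1}" for b
      using card_slice[OF less.prems(1) cr that] .
    have pos: "card (slice Q i b) > 0" "subcube n (slice Q i b)" if "b \<in> {0, 1}" for b
      using slice_nonempty[OF less.prems(1) cr that] finite_subset[OF slice_subset finQ]
        subcube_slice[OF less.prems(1) i] by (auto simp: card_gt_0_iff)
    have IH: "2 * card M \<le> card (slice Q i b)"
      if "b \<in> {0, 1}" "separated n M" "\<And>R. R \<in> M \<Longrightarrow> subcube n R \<and> R \<subset> slice Q i b" for b M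
      using less.hyps[OF _ pos(2) that(2,3)] card[OF that(1)] pos(1)[OF that(1)] that(1) by simp
    show ?thesis
    proof (cases "\<exists>b\<in>{0, 1}. slice Q i b \<in> L")
      case True
      then obtain b where b: "b \<in> {0, 1}" "slice Q i b \<in> L" by blast
      let ?M = "L - {slice Q i b}"
      have "R \<subseteq> slice Q i b" if "R \<in> L" for R
        using subset_slice_of_separated[OF less.prems(1) cr b(1)] less.prems(2,3) b(2) that
        by (simp add: separated_def)
      then have "2 * card ?M \<le> card (slice Q i b)"
        using less.prems(2,3) by (intro IH[OF b(1)]) (auto simp: separated_def)
      moreover have "card L = Suc (card ?M)"
        using card_Suc_Diff1[OF finL b(2)] by simp
      \<comment> \<open>The half has a cell, so at most half as many members as cells means fewer members than
        cells. This leaves room for the half itself.\<close>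
      moreover have "card ?M < card (slice Q i b)"
        using calculation(1) pos(1)[OF b(1)] by linarith
      ultimately show ?thesis using card[OF b(1)] by linarith
    next
      case False
      let ?T = "\<lambda>b. (\<lambda>R. slice R i b) ` L - {{}}"
      have T: "2 * card (?T b) \<le> card (slice Q i b)" if b: "b \<in> {0, 1}" for b
      proof (rule IH[OF b])
        show "separated n (?T b)"
          using less.prems(2) by (auto simp: separated_def intro: nested_or_far_slice)
      next
        fix A assume "A \<in> ?T b"
        then obtain R where R: "R \<in> L" "A = slice R i b" "A \<noteq> {}" by blast
        have "subcube n R" "R \<subset> Q" using less.prems(3) R(1) by auto
        moreover have "A \<noteq> slice Q i b"
          using proper_subcube_eq_slice[OF less.prems(1) cr calculation b] R(1,2) False b
            slice_subset by metis
        ultimately show "subcube n A \<and> A \<subset> slice Q i b"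
          using subcube_slice[OF _ i] R(2,3) by (auto simp: slice_def)
      qed
      have "card L \<le> card (?T 0) + card (?T 1)"
        using card_le_slices[OF finL less.prems(2) i] less.prems(3) by blast
      then show ?thesis using T[of 0] T[of 1] card[of 0] card[of 1] by simp
    qed
  qed simp
qed

section \<open>Islands\<close>

text \<open>
  Two overlapping subcubes fix coordinates to the values of a common cell. A subcube that is not
  contained in the other leaves free some coordinate which the other fixes, and changing that
  coordinate of the common cell leads to a neighbor.
\<close>

lemma overlapping_subcube_meets_neighbors:
  assumes "subcube n R" "subcube n S" "x \<in> R" "x \<in> S" "\<not> S \<subseteq> R"
  shows "S \<inter> neighbors n R \<noteq> {}"
proof -
  obtain F where F: "F \<subseteq> {..<n}" "R = {y \<in> cells n. \<forall>i\<in>F. y i = x i}"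
    using subcube_through[OF assms(1,3)] .
  obtain G where G: "S = {y \<in> cells n. \<forall>i\<in>G. y i = x i}"
    using subcube_through[OF assms(2,4)] .
  obtain i where i: "i \<in> F" "i \<notin> G" using assms(5) F(2) G by blast
  have x: "x \<in> cells n" "i < n" using assms(3) F i(1) by auto
  let ?y = "x(i := 1 - x i)"
  have ne: "1 - x i \<noteq> x i" by arith
  have "?y \<in> cells n" using x by (auto intro!: cells_upd)
  then have "?y \<in> S" "?y \<in> cells n" "?y \<notin> R" using G F(2) i ne by auto
  moreover have "hamming n x ?y = 1" by (rule hamming_upd) (use x(2) ne in auto)
  ultimately have "?y \<in> S \<inter> neighbors n R" using assms(3) by (auto simp: neighbors_def)
  then show ?thesis by blast
qed

lemma island_higher_than_neighbor:
  assumes "island n h R" "y \<in> neighbors n R" "x \<in> R"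
  shows "h y < h x"
proof -
  have "R \<noteq> cells n" using assms(2) by (auto simp: neighbors_def)
  then have "Max (h ` neighbors n R) < Min (h ` R)" using assms(1) by (simp add: island_def)
  moreover have "h y \<le> Max (h ` neighbors n R)" using assms(2) finite_neighbors by simp
  moreover have "finite R" using island_subset[OF assms(1)] finite_cells finite_subset by blast
  then have "Min (h ` R) \<le> h x" using assms(3) by simp
  ultimately show ?thesis by linarith
qed

lemma islands_nested_or_far:
  assumes "island n h R" "island n h S"
  shows "nested_or_far n R S"
proof (rule ccontr)
  assume "\<not> nested_or_far n R S"
  then have nn: "\<not> R \<subseteq> S" "\<not> S \<subseteq> R" and "\<not> far n R S" by (auto simp: nested_or_far_def)
  then obtain x y where xy: "x \<in> R" "y \<in> S" "hamming n x y \<le> 1"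
    by (auto simp: far_def not_less)
  have cells: "x \<in> cells n" "y \<in> cells n" using xy island_subset assms by blast+
  have sub: "subcube n R" "subcube n S" using assms by (auto simp: island_def)
  have "\<exists>u v. u \<in> S \<inter> neighbors n R \<and> v \<in> R \<inter> neighbors n S"
  proof (cases "R \<inter> S = {}")
    case True
    then have "hamming n x y \<noteq> 0" using hamming_eq_0_iff[OF cells] xy by blast
    then have "hamming n x y = 1" "hamming n y x = 1" using xy(3) hamming_commute[of n x y] by auto
    then have "y \<in> S \<inter> neighbors n R" "x \<in> R \<inter> neighbors n S"
      using xy cells True by (auto simp: neighbors_def)
    then show ?thesis by blast
  next
    case False
    then obtain z where "z \<in> R" "z \<in> S" by blast
    then show ?thesis
      using overlapping_subcube_meets_neighbors[OF sub] nn
        overlapping_subcube_meets_neighbors[OF sub(2,1)] by blast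
  qed
  then obtain u v where "u \<in> S" "u \<in> neighbors n R" "v \<in> R" "v \<in> neighbors n S" by blast
  then have "h u < h v" "h v < h u" using island_higher_than_neighbor assms by blast+
  then show False by simp
qed

lemma subcube_cells: "subcube n (cells n)"
proof -
  have "cells n \<noteq> {}" using card_cells[of n] by auto
  then show ?thesis unfolding subcube_def by (intro exI[of _ "{}"]) auto
qed

lemma num_islands_le:
  assumes "n \<ge> 1"
  shows "num_islands n h \<le> 1 + 2 ^ (n - 1)"
proof -
  let ?L = "{R. island n h R} - {cells n}"
  have "2 * card ?L \<le> card (cells n)"
  proof (rule separated_card_le[OF subcube_cells])
    show "separated n ?L" using islands_nested_or_far by (auto simp: separated_def)
    show "subcube n R \<and> R \<subset> cells n" if "R \<in> ?L" for R
      using that island_subset[of n h R] by (auto simp: island_def)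
  qed
  also have "card (cells n) = 2 * 2 ^ (n - 1)"
    using assms by (simp add: card_cells flip: power_Suc)
  finally have "card ?L \<le> 2 ^ (n - 1)" by simp
  moreover have "cells n \<in> {R. island n h R}" by (simp add: island_def subcube_cells)
  then have "num_islands n h = Suc (card ?L)"
    unfolding num_islands_def using card_Suc_Diff1[OF finite_islands] by metis
  ultimately show ?thesis by simp
qed

section \<open>The parity height\<close>

definition even_cell :: "nat \<Rightarrow> (nat \<Rightarrow> nat) \<Rightarrow> bool" where
  "even_cell n x \<longleftrightarrow> even (\<Sum>i<n. x i)"

lemma even_cell_upd:
  assumes "i < n" "x i \<in> {0, 1}"
  shows "even_cell n (x(i := 1 - x i)) \<longleftrightarrow> \<not> even_cell n x"
proof -
  have "(\<Sum>j<n. y j) = y i + (\<Sum>j\<in>{..<n} - {i}. y j)" for y :: "nat \<Rightarrow> nat"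
    using assms(1) by (simp add: sum.remove)
  from this[of x] this[of "x(i := 1 - x i)"] show ?thesis
    using assms(2) by (auto simp: even_cell_def)
qed

lemma card_even_cells:
  assumes "n \<ge> 1"
  shows "card {x \<in> cells n. even_cell n x} = 2 ^ (n - 1)"
proof -
  let ?E = "{x \<in> cells n. even_cell n x}" and ?O = "{x \<in> cells n. \<not> even_cell n x}"
  let ?f = "\<lambda>x::nat \<Rightarrow> nat. x(0 := 1 - x 0)"
  have v: "x 0 \<in> {0, 1}" if "x \<in> cells n" for x
    using cells_value[OF that, of 0] assms by simp
  have "?f x \<in> cells n" "even_cell n (?f x) \<longleftrightarrow> \<not> even_cell n x" "?f (?f x) = x"
    if "x \<in> cells n" for x
    using cells_upd[OF that, of 0 "1 - x 0"] even_cell_upd[of 0 n x] v[OF that] assms by auto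
  then have "bij_betw ?f ?E ?O" by (intro bij_betwI[where g = ?f]) auto
  then have "card ?E = card ?O" by (rule bij_betw_same_card)
  moreover have "card (?E \<union> ?O) = card ?E + card ?O"
    by (rule card_Un_disjoint) (auto simp: finite_cells)
  moreover have "?E \<union> ?O = cells n" by blast
  ultimately have "2 * card ?E = 2 ^ n" by (simp add: card_cells)
  also have "\<dots> = 2 * 2 ^ (n - 1)" using assms by (simp flip: power_Suc)
  finally show ?thesis by simp
qed

lemma subcube_singleton:
  assumes "x \<in> cells n"
  shows "subcube n {x}"
proof -
  have "{x} = {y \<in> cells n. \<forall>i\<in>{..<n}. y i = x i}"
    using assms cells_differ_less[OF _ assms] by (auto simp: fun_eq_iff)
  then show ?thesis using assms unfolding subcube_def by blast
qed

lemma even_singleton_island: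
  assumes "n \<ge> 1" "x \<in> cells n" "even_cell n x"
  shows "island n (\<lambda>y. of_bool (even_cell n y)) {x}"
proof -
  let ?h = "\<lambda>y. of_bool (even_cell n y) :: real"
  have "card (cells n) \<noteq> 1" using assms(1) by (simp add: card_cells)
  then have "card {x} \<noteq> card (cells n)" by simp
  then have "{x} \<noteq> cells n" by metis
  then have "neighbors n {x} \<noteq> {}"
    using neighbors_subcube_nonempty subcube_singleton assms(2) by blast
  moreover have "?h y < 1" if y: "y \<in> neighbors n {x}" for y
  proof -
    have "y \<in> cells n" "hamming n x y = 1" using y by (auto simp: neighbors_def)
    then obtain i where "i < n" "y = x(i := 1 - x i)" using hamming_eq_1E assms(2) by metis
    then show ?thesis using even_cell_upd[of i n x] cells_value[OF assms(2), of i] assms(3) by simp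
  qed
  ultimately have "Max (?h ` neighbors n {x}) < Min (?h ` {x})"
    using finite_neighbors assms(3) by (subst Max_less_iff) auto
  then show ?thesis using subcube_singleton assms(2) by (simp add: island_def)
qed

lemma num_islands_parity_ge:
  assumes "n \<ge> 1"
  shows "1 + 2 ^ (n - 1) \<le> num_islands n (\<lambda>y. of_bool (even_cell n y))"
proof -
  let ?E = "{x \<in> cells n. even_cell n x}"
  let ?I = "insert (cells n) ((\<lambda>x. {x}) ` ?E)"
  have "cells n \<notin> (\<lambda>x. {x}) ` ?E"
  proof
    assume "cells n \<in> (\<lambda>x. {x}) ` ?E"
    then have "card (cells n) = 1" by auto
    then show False using assms by (simp add: card_cells)
  qed
  then have "1 + 2 ^ (n - 1) = card ?I"
    by (simp add: finite_cells card_image card_even_cells[OF assms])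
  also have "\<dots> \<le> card {R. island n (\<lambda>y. of_bool (even_cell n y)) R}"
  proof (rule card_mono[OF finite_islands], rule subsetI)
    fix R assume "R \<in> ?I"
    then consider "R = cells n" | x where "x \<in> cells n" "even_cell n x" "R = {x}" by auto
    then show "R \<in> {R. island n (\<lambda>y. of_bool (even_cell n y)) R}"
    proof cases
      case 1
      then show ?thesis by (simp add: island_def subcube_cells)
    next
      case 2
      then show ?thesis using even_singleton_island[OF assms] by simp
    qed
  qed
  finally show ?thesis by (simp add: num_islands_def)
qed

theorem theorem12:
  fixes n :: nat
  assumes "n \<ge> 1"
  shows "max_islands n = 1 + 2 ^ (n - 1)"
  unfolding max_islands_def
proof (rule Max_eqI[OF finite_range_num_islands])
  show "k \<le> 1 + 2 ^ (n - 1)" if "k \<in> range (num_islands n)" for k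
    using that num_islands_le[OF assms] by auto
  show "1 + 2 ^ (n - 1) \<in> range (num_islands n)"
    by (rule range_eqI, rule le_antisym[OF num_islands_parity_ge[OF assms] num_islands_le[OF assms]])
qed

end
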